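(* Let $K$ be a compact Hausdorff space and let $\mathbb{X}$ be a real Banach space. Let $T\in\mathbb{K}(\mathbb{X},C(K))$ with $\|T\|=1$. Then $T$ is right symmetric in $\mathbb{K}(\mathbb{X},C(K))$ if and only if both of the following hold: (i) $\|T^*(\delta_k)\|=1$ for all $k\in K$; (ii) $T^*(\delta_k)$ is a right symmetric point of $\mathbb{X}^*$ for all $k\in K$.
   Context: $C(K)$ is the Banach space of real-valued continuous functions on $K$ with the supremum norm. $\mathbb{K}(\mathbb{X},\mathbb{Y})$ is the Banach space of compact linear operators from $\mathbb{X}$ to $\mathbb{Y}$ with the operator norm. For $k\in K$, $\delta_k\in C(K)^*$ is given by $\delta_k(f)=f(k)$ for all $f\in C(K)$; $T^*:C(K)^*\to\mathbb{X}^*$ is the adjoint of $T$. For a real Banach space $\mathbb{Z}$ and $x,y\in\mathbb{Z}$, $x\perp_B y$ means $\|x+\lambda y\|\ge\|x\|$ for all $\lambda\in\mathbb{R}$. A point $x\in\mathbb{Z}$ is right symmetric (in $\mathbb{Z}$) if for all $y\in\mathbb{Z}$, $y\perp_B x$ implies $x\perp_B y$. *)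

theory Defs
  imports "HOL-Analysis.Analysis"
begin

text \<open>
  For a compact Hausdorff type \<open>'k\<close>, the space \<open>C(K)\<close> is \<^typ>\<open>'k \<Rightarrow>\<^sub>C real\<close> with its supremum norm:
  every continuous function is then bounded. The dual of \<open>'x\<close> is \<^typ>\<open>'x \<Rightarrow>\<^sub>L real\<close>.
\<close>

definition birkhoff_orthogonal :: "'z::real_normed_vector \<Rightarrow> 'z \<Rightarrow> bool"  (infix \<open>\<bottom>\<^sub>B\<close> 50)
  where "x \<bottom>\<^sub>B y \<longleftrightarrow> (\<forall>c::real. norm (x + c *\<^sub>R y) \<ge> norm x)"

text \<open>
  The set \<open>Z\<close> is meant to be a linear subspace with the inherited norm, so that subspaces such as
  the compact operators need no type of their own; \<open>Z = UNIV\<close> gives the whole space.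
\<close>

definition right_symmetric_in :: "'z::real_normed_vector \<Rightarrow> 'z set \<Rightarrow> bool"
  where "right_symmetric_in x Z \<longleftrightarrow> x \<in> Z \<and> (\<forall>y\<in>Z. y \<bottom>\<^sub>B x \<longrightarrow> x \<bottom>\<^sub>B y)"

definition compact_operators :: "('x::real_normed_vector \<Rightarrow>\<^sub>L 'y::real_normed_vector) set"
  where "compact_operators = {T. compact (closure (blinfun_apply T ` cball 0 1))}"

lift_definition point_evaluation :: "'k::topological_space \<Rightarrow> ('k \<Rightarrow>\<^sub>C real) \<Rightarrow>\<^sub>L real"
  is "\<lambda>k f. apply_bcontfun f k"
proof -
  fix k :: 'k
  have "norm (apply_bcontfun f k) \<le> norm f" for f :: "'k \<Rightarrow>\<^sub>C real"
    by (rule norm_bounded)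
  then show "bounded_linear (\<lambda>f. apply_bcontfun f k :: real)"
    by (intro bounded_linear_intro[where K = 1])
      (simp_all add: plus_bcontfun.rep_eq scaleR_bcontfun.rep_eq)
qed

lift_definition adjoint_operator ::
  "('x::real_normed_vector \<Rightarrow>\<^sub>L 'y::real_normed_vector) \<Rightarrow> ('y \<Rightarrow>\<^sub>L real) \<Rightarrow>\<^sub>L ('x \<Rightarrow>\<^sub>L real)"
  is "\<lambda>T \<phi>. \<phi> o\<^sub>L T"
  by (rule bounded_bilinear.bounded_linear_left[OF bounded_bilinear_blinfun_compose])

end

theory Submission
  imports Defs
begin

text \<open>
  A compact operator into \<open>C(K)\<close> is a norm-continuous function \<open>k \<mapsto> T\<^sup>*\<delta>\<^sub>k\<close> into the dual of \<open>X\<close>, with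
  the supremum norm. If \<open>G \<bottom>\<^sub>B T\<close>, compactness of \<open>K\<close> yields for each sign of the scalar a point where
  \<open>G\<close> attains its norm and is one-sidedly orthogonal to \<open>T\<close>; at a right symmetric point one-sided
  orthogonality can be reversed too, and as every \<open>T\<^sup>*\<delta>\<^sub>k\<close> has norm 1 it then reverses globally.
  Conversely, a \<open>y\<close> with \<open>\<parallel>T\<^sup>*\<delta>\<^sub>k + y\<parallel> < 1\<close> extends, by a Urysohn function \<open>h\<close> concentrated near \<open>k\<close>, to
  \<open>G = h y - (1 - h) \<parallel>y\<parallel> T\<close>, for which \<open>\<parallel>T + G\<parallel> < 1\<close>. If (ii) fails, take for \<open>y\<close> a multiple of a vector
  witnessing the failure; if (i) fails, a small positive multiple of \<open>T\<^sup>*\<delta>\<^sub>k\<close> (of any vector if that is 0).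
  Then \<open>G \<bottom>\<^sub>B T\<close>: at \<open>k\<close> the norm of \<open>G\<close> is attained and \<open>y\<close> is orthogonal to \<open>T\<^sup>*\<delta>\<^sub>k\<close>, in case (i) for scalars
  \<open>c \<ge> 0\<close> only; scalars \<open>c < 0\<close> are handled at a point where \<open>T\<close> attains its norm and \<open>G = - \<parallel>y\<parallel> T\<close>.
\<close>

section \<open>One-sided Birkhoff orthogonality\<close>

text \<open>Convexity of the norm: \<open>y + c *\<^sub>R x\<close> is a mean of \<open>y\<close>
  and \<open>y + d *\<^sub>R x\<close> with positive weight on the latter, so if \<open>y\<close>
  contributes at most \<open>N\<close>, the far point contributes at least \<open>N\<close>.\<close>

lemma norm_ray_mono:
  fixes x y :: "'z::real_normed_vector"
  assumes "norm y \<le> N" "N \<le> norm (y + c *\<^sub>R x)" "0 < c" "c \<le> d"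
  shows "N \<le> norm (y + d *\<^sub>R x)"
proof -
  have "y + c *\<^sub>R x = (1 - c / d) *\<^sub>R y + (c / d) *\<^sub>R (y + d *\<^sub>R x)"
    using assms by (simp add: algebra_simps)
  then have "N \<le> norm ((1 - c / d) *\<^sub>R y + (c / d) *\<^sub>R (y + d *\<^sub>R x))"
    using assms(2) by (simp only:)
  also have "\<dots> \<le> norm ((1 - c / d) *\<^sub>R y) + norm ((c / d) *\<^sub>R (y + d *\<^sub>R x))"
    by (rule norm_triangle_ineq)
  also have "\<dots> = (1 - c / d) * norm y + (c / d) * norm (y + d *\<^sub>R x)"
    using assms by simp
  also have "\<dots> \<le> (1 - c / d) * N + (c / d) * norm (y + d *\<^sub>R x)"
    using assms by (intro add_right_mono mult_left_mono) auto
  finally have "(c / d) * N \<le> (c / d) * norm (y + d *\<^sub>R x)"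
    by (simp add: algebra_simps)
  then show ?thesis
    by (rule mult_left_le_imp_le) (use assms in simp)
qed

text \<open>Symmetry applies to a shifted vector \<open>y - a *\<^sub>R x\<close> with a \<ge> 0.
  Since x + c y = (1 + c a) x + c (y - a x) and 1 + c a \<ge> 1, undoing the shift keeps the lower
  bound \<open>norm x\<close>.\<close>

lemma right_symmetric_one_sided:
  fixes x y :: "'z::real_normed_vector"
  assumes sym: "right_symmetric_in x UNIV" and "x \<noteq> 0"
    and y: "\<And>c. 0 \<le> c \<Longrightarrow> norm y \<le> norm (y + c *\<^sub>R x)" and "0 \<le> c"
  shows "norm x \<le> norm (x + c *\<^sub>R y)"
proof -
  \<comment> \<open>For b > M the triangle inequality gives norm (y - b x) \<ge> b norm x - norm y
    \<ge> norm y, so a minimum over \<open>{0..M}\<close> is global; the hypothesis on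
    \<open>y\<close> covers b < 0.\<close>
  define M where "M = 2 * norm y / norm x"
  have "0 \<le> M"
    by (simp add: M_def)
  text \<open>Moving \<open>y\<close> to the minimum of \<open>a \<mapsto> \<parallel>y - a x\<parallel>\<close>, which lies at some \<open>a \<ge> 0\<close>, makes the
    orthogonality two-sided.\<close>
  have "continuous_on {0..M} (\<lambda>a. norm (y - a *\<^sub>R x))"
    by (intro continuous_intros)
  then obtain a where a: "0 \<le> a"
    and min: "\<And>b. 0 \<le> b \<Longrightarrow> b \<le> M \<Longrightarrow> norm (y - a *\<^sub>R x) \<le> norm (y - b *\<^sub>R x)"
    using continuous_attains_inf[of "{0..M}" "\<lambda>a. norm (y - a *\<^sub>R x)"] \<open>0 \<le> M\<close>
    by auto
  have min0: "norm (y - a *\<^sub>R x) \<le> norm y"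
    using min[of 0] \<open>0 \<le> M\<close> by simp
  have "norm (y - a *\<^sub>R x) \<le> norm (y - b *\<^sub>R x)" for b
  proof -
    consider "b < 0" | "0 \<le> b" "b \<le> M" | "M < b"
      by linarith
    then show ?thesis
    proof cases
      case 1
      then show ?thesis
        using y[of "- b"] min0 by simp
    next
      case 2
      then show ?thesis
        by (rule min)
    next
      case 3
      then have "2 * norm y \<le> b * norm x"
        using \<open>x \<noteq> 0\<close> by (simp add: M_def field_simps)
      moreover have "b * norm x \<le> norm (y - b *\<^sub>R x) + norm y"
        using norm_triangle_sub[of "b *\<^sub>R x" y] 3 \<open>0 \<le> M\<close>
        by (simp add: norm_minus_commute)
      ultimately show ?thesis
        using min0 by linarith
    qed
  qed
  from this[of "a - b" for b] have "(y - a *\<^sub>R x) \<bottom>\<^sub>B x"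
    by (simp add: birkhoff_orthogonal_def algebra_simps)
  then have orth: "x \<bottom>\<^sub>B (y - a *\<^sub>R x)"
    using sym by (simp add: right_symmetric_in_def)
  have pos: "0 < 1 + c * a"
    using a \<open>0 \<le> c\<close> by (simp add: add_pos_nonneg)
  have "norm x \<le> (1 + c * a) * norm x"
    using a \<open>0 \<le> c\<close> by (simp add: algebra_simps)
  also have "\<dots> \<le> (1 + c * a) * norm (x + (c / (1 + c * a)) *\<^sub>R (y - a *\<^sub>R x))"
    using orth pos by (intro mult_left_mono) (auto simp: birkhoff_orthogonal_def)
  also have "\<dots> = norm ((1 + c * a) *\<^sub>R (x + (c / (1 + c * a)) *\<^sub>R (y - a *\<^sub>R x)))"
    using pos by simp
  also have "(1 + c * a) *\<^sub>R (x + (c / (1 + c * a)) *\<^sub>R (y - a *\<^sub>R x)) = (1 + c * a) *\<^sub>R x + c *\<^sub>R (y - a *\<^sub>R x)"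
    using pos by (simp add: scaleR_add_right[of "1 + c * a"])
  also have "\<dots> = x + c *\<^sub>R y"
    by (simp add: algebra_simps)
  finally show ?thesis .
qed

section \<open>Operators into \<open>C(K)\<close> as functions on \<open>K\<close>\<close>

abbreviation slice :: "('x::real_normed_vector \<Rightarrow>\<^sub>L ('k::topological_space \<Rightarrow>\<^sub>C real)) \<Rightarrow> 'k \<Rightarrow> 'x \<Rightarrow>\<^sub>L real"
  where "slice T k \<equiv> adjoint_operator T (point_evaluation k)"

lemma slice_apply [simp]: "slice T k x = apply_bcontfun (T x) k"
  by (simp add: adjoint_operator.rep_eq point_evaluation.rep_eq)

lemma slice_add: "slice (S + T) k = slice S k + slice T k"
  by (rule blinfun_eqI) (simp add: blinfun.add_left)

lemma slice_scaleR: "slice (c *\<^sub>R T) k = c *\<^sub>R slice T k"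
  by (rule blinfun_eqI) (simp add: blinfun.scaleR_left)

lemma norm_slice_le: "norm (slice T k) \<le> norm T"
proof (rule norm_blinfun_bound)
  show "norm (slice T k x) \<le> norm T * norm x" for x
    using norm_bounded[of "T x" k] norm_blinfun[of T x] by simp
qed simp

text \<open>With \<open>norm_slice_le\<close> this makes the operator norm the supremum of the slice
  norms.\<close>

lemma norm_le_slice_bound:
  assumes "\<And>k. norm (slice T k) \<le> b"
  shows "norm T \<le> b"
proof (rule norm_blinfun_bound)
  show "0 \<le> b"
    using assms norm_ge_zero order_trans by blast
  show "norm (T x) \<le> b * norm x" for x
  proof (rule norm_bound)
    fix k
    have "norm (slice T k x) \<le> norm (slice T k) * norm x"
      by (rule norm_blinfun)
    also have "\<dots> \<le> b * norm x"
      by (intro mult_right_mono assms) simp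
    finally show "norm (apply_bcontfun (T x) k) \<le> b * norm x"
      by simp
  qed
qed

text \<open>Any compact superset of the image will do, which spares computing closures for sums and
  compositions.\<close>

lemma compact_operators_iff_image_subset:
  "T \<in> compact_operators \<longleftrightarrow> (\<exists>C. compact C \<and> blinfun_apply T ` cball 0 1 \<subseteq> C)"
proof
  assume "T \<in> compact_operators"
  then show "\<exists>C. compact C \<and> blinfun_apply T ` cball 0 1 \<subseteq> C"
    unfolding compact_operators_def
    by (intro exI[of _ "closure (blinfun_apply T ` cball 0 1)"]) (simp add: closure_subset)
next
  assume "\<exists>C. compact C \<and> blinfun_apply T ` cball 0 1 \<subseteq> C"
  then obtain C where "compact C" "blinfun_apply T ` cball 0 1 \<subseteq> C"
    by blast
  then have "closure (blinfun_apply T ` cball 0 1) \<subseteq> C"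
    by (intro closure_minimal compact_imp_closed)
  then have "compact (closure (blinfun_apply T ` cball 0 1))"
    by (metis Int_absorb1 \<open>compact C\<close> closed_closure compact_Int_closed)
  then show "T \<in> compact_operators"
    by (simp add: compact_operators_def)
qed

lemma compact_operators_add:
  assumes "S \<in> compact_operators" "T \<in> compact_operators"
  shows "S + T \<in> compact_operators"
proof -
  obtain C D where C: "compact C" "blinfun_apply S ` cball 0 1 \<subseteq> C"
    and D: "compact D" "blinfun_apply T ` cball 0 1 \<subseteq> D"
    using assms by (auto simp: compact_operators_iff_image_subset)
  have "blinfun_apply (S + T) ` cball 0 1 \<subseteq> {x + y |x y. x \<in> C \<and> y \<in> D}"
    using C(2) D(2) by (fastforce simp: blinfun.add_left)
  with compact_sums[OF C(1) D(1)] show ?thesis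
    unfolding compact_operators_iff_image_subset by blast
qed

lemma compact_operators_compose_left:
  assumes "T \<in> compact_operators"
  shows "A o\<^sub>L T \<in> compact_operators"
proof -
  obtain C where C: "compact C" "blinfun_apply T ` cball 0 1 \<subseteq> C"
    using assms by (auto simp: compact_operators_iff_image_subset)
  have "compact (blinfun_apply A ` C)"
    using C(1) by (intro compact_continuous_image continuous_intros)
  moreover have "blinfun_apply (A o\<^sub>L T) ` cball 0 1 \<subseteq> blinfun_apply A ` C"
    using C(2) by auto
  ultimately show ?thesis
    unfolding compact_operators_iff_image_subset by blast
qed

lemma compact_operators_scaleR:
  assumes "T \<in> compact_operators"
  shows "c *\<^sub>R T \<in> compact_operators"
proof -
  have "c *\<^sub>R T = (c *\<^sub>R id_blinfun) o\<^sub>L T"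
    by (rule blinfun_eqI) (simp add: blinfun.scaleR_left)
  then show ?thesis
    using compact_operators_compose_left[OF assms] by metis
qed

lemma compact_operators_functional:
  fixes \<phi> :: "'x::real_normed_vector \<Rightarrow>\<^sub>L real"
  shows "\<phi> \<in> compact_operators"
proof -
  have "blinfun_apply \<phi> ` cball 0 1 \<subseteq> cball 0 (norm \<phi>)"
  proof (clarsimp)
    fix x :: 'x
    assume "norm x \<le> 1"
    then have "norm \<phi> * norm x \<le> norm \<phi>"
      by (simp add: mult_left_le)
    then show "\<bar>\<phi> x\<bar> \<le> norm \<phi>"
      using norm_blinfun[of \<phi> x] by simp
  qed
  then show ?thesis
    unfolding compact_operators_iff_image_subset using compact_cball by blast
qed

text \<open>The easy half of Arzela-Ascoli: the image of the unit ball is totally bounded, so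
  finitely many functions approximate every \<open>T x\<close> uniformly, and these are
  simultaneously close to their values at \<open>k0\<close> near \<open>k0\<close>.\<close>

lemma continuous_on_slice:
  fixes T :: "'x::real_normed_vector \<Rightarrow>\<^sub>L ('k::topological_space \<Rightarrow>\<^sub>C real)"
  assumes "T \<in> compact_operators"
  shows "continuous_on UNIV (slice T)"
  unfolding continuous_on_def
proof (intro ballI tendstoI)
  fix k0 :: 'k and e :: real
  assume "0 < e"
  \<comment> \<open>Three errors below \<open>d\<close> bound the operator norm by
    \<open>3 * d\<close>, which must stay strictly below \<open>e\<close>.\<close>
  define d where "d = e / 4"
  have "0 < d"
    using \<open>0 < e\<close> by (simp add: d_def)
  define S where "S = closure (blinfun_apply T ` cball 0 1)"
  have "seq_compact S"
    using assms by (simp add: S_def compact_operators_def compact_imp_seq_compact)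
  from seq_compact_imp_totally_bounded[OF this, rule_format, OF \<open>0 < d\<close>]
  obtain F where F: "finite F" "S \<subseteq> (\<Union>f\<in>F. ball f d)"
    by (elim exE conjE)
  have "\<forall>\<^sub>F k in at k0. dist (apply_bcontfun f k) (apply_bcontfun f k0) < d" for f :: "'k \<Rightarrow>\<^sub>C real"
    using continuous_on_apply_bcontfun[of UNIV f] \<open>0 < d\<close>
    by (intro tendstoD) (simp_all add: continuous_on_def)
  then have "\<forall>\<^sub>F k in at k0. \<forall>f\<in>F. dist (apply_bcontfun f k) (apply_bcontfun f k0) < d"
    by (intro eventually_ball_finite F(1) ballI)
  then show "\<forall>\<^sub>F k in at k0 within UNIV. dist (slice T k) (slice T k0) < e"
  proof eventually_elim
    case (elim k)
    have *: "\<bar>(slice T k - slice T k0) x\<bar> \<le> 3 * d" if "norm x \<le> 1" for x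
    proof -
      have "T x \<in> S"
        using that closure_subset unfolding S_def by fastforce
      then obtain f where f: "f \<in> F" "dist f (T x) < d"
        using F(2) by auto
      have "dist (apply_bcontfun f j) (apply_bcontfun (T x) j) < d" for j
        using f(2) dist_bounded le_less_trans by blast
      moreover have "dist (apply_bcontfun f k) (apply_bcontfun f k0) < d"
        using elim f(1) by blast
      ultimately have "\<bar>apply_bcontfun (T x) k - apply_bcontfun (T x) k0\<bar> \<le> 3 * d"
        unfolding dist_real_def by (smt (verit))
      then show ?thesis
        by (simp add: blinfun.diff_left)
    qed
    have "norm (slice T k - slice T k0) \<le> 3 * d"
    proof (rule norm_blinfun_bound)
      fix x :: 'x
      show "norm ((slice T k - slice T k0) x) \<le> 3 * d * norm x"
      proof (cases "x = 0")
        case False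
        then show ?thesis
          using *[of "x /\<^sub>R norm x"] by (simp add: blinfun.scaleR_right divide_simps abs_mult)
      qed (simp add: blinfun.zero_right)
    qed (use \<open>0 < d\<close> in simp)
    also have "\<dots> < e"
      using \<open>0 < e\<close> by (simp add: d_def)
    finally show ?case
      by (simp add: dist_norm)
  qed
qed

lemma norm_slice_attained:
  fixes T :: "'x::real_normed_vector \<Rightarrow>\<^sub>L ('k::topological_space \<Rightarrow>\<^sub>C real)"
  assumes "compact (UNIV :: 'k set)" "T \<in> compact_operators"
  obtains k where "norm (slice T k) = norm T"
proof -
  obtain k where "\<And>j. norm (slice T j) \<le> norm (slice T k)"
    using continuous_attains_sup[OF assms(1) _ continuous_on_norm[OF continuous_on_slice[OF assms(2)]]]
    by auto
  then have "norm T \<le> norm (slice T k)"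
    by (rule norm_le_slice_bound)
  with norm_slice_le[of T k] that show ?thesis
    by force
qed

text \<open>For each c > 0 the good points form a closed set, nonempty because G + c F attains its
  norm at a slice. By \<open>norm_ray_mono\<close> these sets grow with c, so compactness yields a
  point common to all.\<close>

lemma one_sided_orthogonal_slice:
  fixes G F :: "'x::real_normed_vector \<Rightarrow>\<^sub>L ('k::topological_space \<Rightarrow>\<^sub>C real)"
  assumes K: "compact (UNIV :: 'k set)"
    and G: "G \<in> compact_operators" and F: "F \<in> compact_operators"
    and orth: "\<And>c. 0 \<le> c \<Longrightarrow> norm G \<le> norm (G + c *\<^sub>R F)"
  obtains k where "norm (slice G k) = norm G"
    and "\<And>c. 0 \<le> c \<Longrightarrow> norm (slice G k) \<le> norm (slice G k + c *\<^sub>R slice F k)"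
proof -
  define A where "A c = {k. norm G \<le> norm (slice G k + c *\<^sub>R slice F k)}" for c
  have "UNIV \<inter> \<Inter> (A ` {0<..}) \<noteq> {}"
  proof (rule compact_imp_fip_image[OF K])
    show "closed (A c)" for c
      unfolding A_def
      by (intro closed_Collect_le continuous_intros continuous_on_slice G F)
    fix I :: "real set"
    assume I: "finite I" "I \<subseteq> {0<..}"
    \<comment> \<open>The least scalar gives the smallest set; inserting 1 covers empty
      \<open>I\<close>.\<close>
    define m where "m = Min (insert 1 I)"
    have "0 < m"
      using I by (auto simp: m_def)
    have "G + m *\<^sub>R F \<in> compact_operators"
      by (intro compact_operators_add compact_operators_scaleR G F)
    then obtain k where k: "norm (slice (G + m *\<^sub>R F) k) = norm (G + m *\<^sub>R F)"
      using norm_slice_attained[OF K] by blast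
    then have "norm G \<le> norm (slice G k + m *\<^sub>R slice F k)"
      using orth[of m] \<open>0 < m\<close> by (simp add: slice_add slice_scaleR)
    then have "k \<in> A c" if "m \<le> c" for c
      using norm_ray_mono[OF norm_slice_le _ \<open>0 < m\<close> that] by (simp add: A_def)
    moreover have "m \<le> c" if "c \<in> I" for c
      using that I(1) by (simp add: m_def)
    ultimately show "UNIV \<inter> \<Inter> (A ` I) \<noteq> {}"
      by blast
  qed
  then obtain k where k: "\<And>c. 0 < c \<Longrightarrow> norm G \<le> norm (slice G k + c *\<^sub>R slice F k)"
    by (auto simp: A_def)
  \<comment> \<open>Letting c tend to 0 from above shows that \<open>G\<close> attains its norm at
    \<open>k\<close>.\<close>
  have "((\<lambda>c. norm (slice G k + c *\<^sub>R slice F k)) \<longlongrightarrow> norm (slice G k + 0 *\<^sub>R slice F k)) (at_right 0)"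
    by (intro tendsto_intros)
  moreover have "\<forall>\<^sub>F c in at_right 0. norm G \<le> norm (slice G k + c *\<^sub>R slice F k)"
    using k by (auto simp: eventually_at_right_field intro: exI[of _ 1])
  ultimately have "norm G \<le> norm (slice G k + 0 *\<^sub>R slice F k)"
    by (intro tendsto_lowerbound) auto
  then have eq: "norm (slice G k) = norm G"
    using norm_slice_le[of G k] by simp
  have "norm (slice G k) \<le> norm (slice G k + c *\<^sub>R slice F k)" if "0 \<le> c" for c
    using k[of c] that eq by (cases "c = 0") auto
  with eq that show ?thesis
    by blast
qed

section \<open>Localised perturbations\<close>

lemma Urysohn_compact_t2:
  fixes k :: "'k::t2_space"
  assumes "compact (UNIV :: 'k set)" "open V" "k \<in> V"
  obtains h :: "'k \<Rightarrow> real" where "continuous_on UNIV h" "\<And>j. 0 \<le> h j" "\<And>j. h j \<le> 1"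
    "h k = 1" "\<And>j. j \<notin> V \<Longrightarrow> h j = 0"
proof -
  have "Hausdorff_space (euclidean :: 'k topology)"
    unfolding Hausdorff_space_def disjnt_def open_openin[symmetric]
    by (intro allI impI, elim conjE) (rule hausdorff)
  moreover have "compact_space (euclidean :: 'k topology)"
    using assms(1) by (simp add: compact_space_def)
  ultimately have "normal_space (euclidean :: 'k topology)"
    by (simp add: compact_Hausdorff_or_regular_imp_normal_space)
  moreover have "closedin euclidean (- V)" "closedin euclidean {k}" "disjnt (- V) {k}"
    using assms by (auto simp: disjnt_def)
  ultimately obtain h where h: "continuous_map euclidean (top_of_set {0..1}) h"
    "h ` (- V) \<subseteq> {0::real}" "h ` {k} \<subseteq> {1}"
    using Urysohn_lemma[of euclidean "- V" "{k}" 0 1] by auto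
  then have "continuous_on UNIV h" "h \<in> UNIV \<rightarrow> {0..1}"
    by (auto simp: continuous_map_in_subtopology)
  with h(2,3) show ?thesis
    by (intro that[of h]) (auto simp: Pi_iff)
qed

text \<open>Multiplying by \<open>h\<close> as a bounded operator lets cut-off operators inherit
  compactness by composition.\<close>

lemma multiplication_operator:
  fixes h :: "'k::topological_space \<Rightarrow> real"
  assumes "continuous_on UNIV h" "\<And>j. \<bar>h j\<bar> \<le> 1"
  obtains M :: "('k \<Rightarrow>\<^sub>C real) \<Rightarrow>\<^sub>L ('k \<Rightarrow>\<^sub>C real)"
  where "\<And>f j. apply_bcontfun (M f) j = h j * apply_bcontfun f j"
proof -
  define m where "m f = Bcontfun (\<lambda>j. h j * apply_bcontfun f j)" for f
  have bound: "\<bar>h j * apply_bcontfun f j\<bar> \<le> norm f" for f j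
    using mult_mono[OF assms(2)[of j] norm_bounded[of f j]] by (simp add: abs_mult)
  have "(\<lambda>j. h j * apply_bcontfun f j) \<in> bcontfun" for f
    by (rule bcontfun_normI[where b = "norm f"])
      (use bound in \<open>auto intro!: continuous_intros assms(1)\<close>)
  then have m: "apply_bcontfun (m f) j = h j * apply_bcontfun f j" for f j
    by (simp add: m_def Bcontfun_inverse)
  have "bounded_linear m"
  proof (rule bounded_linear_intro[where K = 1])
    show "norm (m f) \<le> norm f * 1" for f
      using norm_bound[of "m f" "norm f"] bound by (simp add: m)
  qed (auto intro!: bcontfun_eqI simp: m algebra_simps)
  then show ?thesis
    using that[of "Blinfun m"] m by (simp add: bounded_linear_Blinfun_apply)
qed

text \<open>The slices of \<open>F + G\<close> average \<open>slice F j + y\<close> and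
  \<open>(1 - norm y) *\<^sub>R slice F j\<close> with weights \<open>h j\<close> and
  \<open>1 - h j\<close>. The second has norm below 1 because 0 < norm y < 2, the first wherever
  \<open>h j\<close> is nonzero. The set \<open>V\<close> controls where \<open>G\<close> is a
  multiple of \<open>F\<close>.\<close>

lemma localised_perturbation:
  fixes F :: "'x::real_normed_vector \<Rightarrow>\<^sub>L ('k::t2_space \<Rightarrow>\<^sub>C real)"
  assumes K: "compact (UNIV :: 'k set)"
    and F: "F \<in> compact_operators" and "norm F = 1"
    and V: "open V" "k \<in> V"
    and y: "norm (slice F k + y) < 1" "y \<noteq> 0"
  obtains G where "G \<in> compact_operators" "slice G k = y" "norm G = norm y"
    "\<And>j. j \<notin> V \<Longrightarrow> slice G j = - norm y *\<^sub>R slice F j" "\<not> F \<bottom>\<^sub>B G"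
proof -
  have slice_F: "norm (slice F j) \<le> 1" for j
    using norm_slice_le[of F j] \<open>norm F = 1\<close> by simp
  have "norm y \<le> norm (slice F k + y) + norm (slice F k)"
    using norm_triangle_ineq4[of "slice F k + y" "slice F k"] by simp
  then have y2: "norm y < 2"
    using y(1) slice_F[of k] by linarith
  define U where "U = V \<inter> {j. norm (slice F j + y) < 1}"
  have "open U"
    unfolding U_def
    by (intro open_Int V open_Collect_less continuous_intros continuous_on_slice F)
  moreover have "k \<in> U"
    using V y by (simp add: U_def)
  ultimately obtain h :: "'k \<Rightarrow> real" where h: "continuous_on UNIV h" "\<And>j. 0 \<le> h j" "\<And>j. h j \<le> 1"
    "h k = 1" "\<And>j. j \<notin> U \<Longrightarrow> h j = 0"
    using Urysohn_compact_t2[OF K] by metis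
  obtain M :: "('k \<Rightarrow>\<^sub>C real) \<Rightarrow>\<^sub>L ('k \<Rightarrow>\<^sub>C real)"
    where M: "\<And>f j. apply_bcontfun (M f) j = h j * apply_bcontfun f j"
    using multiplication_operator[OF h(1)] h(2,3) by (metis abs_of_nonneg)
  \<comment> \<open>The first summand is the rank-one operator sending x to y(x) h; the second is -
    norm y (1 - h) F.\<close>
  define G where "G = ((M o\<^sub>L blinfun_scaleR_left (const_bcontfun 1)) o\<^sub>L y) +
    (- norm y) *\<^sub>R (F + (-1) *\<^sub>R (M o\<^sub>L F))"
  have G: "G \<in> compact_operators"
    unfolding G_def
    by (intro compact_operators_add compact_operators_scaleR compact_operators_compose_left
        compact_operators_functional F)
  have slice_G: "slice G j = h j *\<^sub>R y - ((1 - h j) * norm y) *\<^sub>R slice F j" for j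
    by (rule blinfun_eqI)
      (simp add: G_def M blinfun.add_left blinfun.scaleR_left blinfun.diff_left algebra_simps)
  have "norm (slice G j) \<le> norm y" for j
  proof -
    have "norm (slice G j) \<le> norm (h j *\<^sub>R y) + norm (((1 - h j) * norm y) *\<^sub>R slice F j)"
      unfolding slice_G by (rule norm_triangle_ineq4)
    also have "\<dots> = h j * norm y + (1 - h j) * norm y * norm (slice F j)"
      using h by (simp add: abs_mult)
    also have "\<dots> \<le> h j * norm y + (1 - h j) * norm y * 1"
      using h slice_F by (intro add_left_mono mult_left_mono) auto
    finally show ?thesis
      by (simp add: algebra_simps)
  qed
  then have "norm G \<le> norm y"
    by (rule norm_le_slice_bound)
  moreover have Gk: "slice G k = y"
    by (simp add: slice_G h(4))
  ultimately have normG: "norm G = norm y"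
    using norm_slice_le[of G k] by simp
  have less: "norm (slice (F + G) j) < 1" for j
  proof -
    have "slice (F + G) j = h j *\<^sub>R (slice F j + y) + ((1 - h j) * (1 - norm y)) *\<^sub>R slice F j"
      by (simp add: slice_add slice_G algebra_simps)
    then have "norm (slice (F + G) j) \<le>
        norm (h j *\<^sub>R (slice F j + y)) + norm (((1 - h j) * (1 - norm y)) *\<^sub>R slice F j)"
      by (simp only: norm_triangle_ineq)
    also have "\<dots> = h j * norm (slice F j + y) + (1 - h j) * \<bar>1 - norm y\<bar> * norm (slice F j)"
      using h by (simp add: abs_mult)
    also have "\<dots> \<le> h j * norm (slice F j + y) + (1 - h j) * \<bar>1 - norm y\<bar> * 1"
      using h slice_F by (intro add_left_mono mult_left_mono) auto
    finally have *: "norm (slice (F + G) j) \<le> h j * norm (slice F j + y) + (1 - h j) * \<bar>1 - norm y\<bar>"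
      by simp
    have **: "\<bar>1 - norm y\<bar> < 1"
      using y2 zero_less_norm_iff[of y] y(2) by linarith
    show ?thesis
    proof (cases "j \<in> U")
      case True
      then have "h j * norm (slice F j + y) + (1 - h j) * \<bar>1 - norm y\<bar> < 1"
        using ** h by (intro convex_bound_lt) (simp_all add: U_def)
      with * show ?thesis
        by linarith
    next
      case False
      then show ?thesis
        using * ** h(5) by simp
    qed
  qed
  \<comment> \<open>Attainment turns the strict pointwise bounds into a strict bound on the
    norm.\<close>
  obtain j where "norm (slice (F + G) j) = norm (F + G)"
    using norm_slice_attained[OF K compact_operators_add[OF F G]] .
  then have "norm (F + 1 *\<^sub>R G) < norm F"
    using less[of j] \<open>norm F = 1\<close> by simp
  then have "\<not> F \<bottom>\<^sub>B G"
    unfolding birkhoff_orthogonal_def by (meson not_le)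
  moreover have "slice G j = - norm y *\<^sub>R slice F j" if "j \<notin> V" for j
    using h(5)[of j] that by (simp add: slice_G U_def)
  ultimately show ?thesis
    using that G Gk normG by blast
qed

section \<open>The characterisation\<close>

lemma slice_right_symmetric_one_sided:
  fixes F G :: "'x::real_normed_vector \<Rightarrow>\<^sub>L ('k::topological_space \<Rightarrow>\<^sub>C real)"
  assumes K: "compact (UNIV :: 'k set)"
    and F: "F \<in> compact_operators" and "norm F = 1" and G: "G \<in> compact_operators"
    and unit: "\<And>k. norm (slice F k) = 1" and sym: "\<And>k. right_symmetric_in (slice F k) UNIV"
    and orth: "\<And>c. 0 \<le> c \<Longrightarrow> norm G \<le> norm (G + c *\<^sub>R F)" and "0 \<le> c"
  shows "norm F \<le> norm (F + c *\<^sub>R G)"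
proof -
  obtain k where k: "\<And>c. 0 \<le> c \<Longrightarrow> norm (slice G k) \<le> norm (slice G k + c *\<^sub>R slice F k)"
    using one_sided_orthogonal_slice[OF K G F orth] by blast
  have "slice F k \<noteq> 0"
    using unit[of k] by force
  then have "norm (slice F k) \<le> norm (slice F k + c *\<^sub>R slice G k)"
    using right_symmetric_one_sided[OF sym _ k \<open>0 \<le> c\<close>] by blast
  also have "\<dots> \<le> norm (F + c *\<^sub>R G)"
    using norm_slice_le[of "F + c *\<^sub>R G" k] by (simp add: slice_add slice_scaleR)
  finally show ?thesis
    using unit[of k] \<open>norm F = 1\<close> by simp
qed

lemma right_symmetric_if_slices:
  fixes F :: "'x::real_normed_vector \<Rightarrow>\<^sub>L ('k::topological_space \<Rightarrow>\<^sub>C real)"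
  assumes K: "compact (UNIV :: 'k set)"
    and F: "F \<in> compact_operators" "norm F = 1"
    and unit: "\<And>k. norm (slice F k) = 1" and sym: "\<And>k. right_symmetric_in (slice F k) UNIV"
  shows "right_symmetric_in F compact_operators"
  unfolding right_symmetric_in_def
proof (intro conjI ballI impI F(1))
  fix G :: "'x \<Rightarrow>\<^sub>L ('k \<Rightarrow>\<^sub>C real)"
  assume G: "G \<in> compact_operators" and "G \<bottom>\<^sub>B F"
  then have orth: "norm G \<le> norm (G + c *\<^sub>R F)" for c
    by (simp add: birkhoff_orthogonal_def)
  \<comment> \<open>Negative scalars for \<open>G\<close> are positive ones for \<open>- G\<close>,
    which is orthogonal to \<open>F\<close> too.\<close>
  have G': "- G \<in> compact_operators"
    using compact_operators_scaleR[OF G, of "- 1"] by simp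
  have orth': "norm (- G) \<le> norm (- G + c *\<^sub>R F)" for c
    using orth[of "- c"] norm_minus_cancel[of "G + (- c) *\<^sub>R F"] by simp
  have "norm F \<le> norm (F + c *\<^sub>R G)" for c
  proof (cases "0 \<le> c")
    case True
    with slice_right_symmetric_one_sided[OF K F G unit sym orth] show ?thesis .
  next
    case False
    with slice_right_symmetric_one_sided[OF K F G' unit sym orth', of "- c"] show ?thesis
      by simp
  qed
  then show "F \<bottom>\<^sub>B G"
    by (simp add: birkhoff_orthogonal_def)
qed

lemma norm_slice_if_right_symmetric:
  fixes F :: "'x::real_normed_vector \<Rightarrow>\<^sub>L ('k::t2_space \<Rightarrow>\<^sub>C real)"
  assumes K: "compact (UNIV :: 'k set)" and "norm F = 1"
    and sym: "right_symmetric_in F compact_operators"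
  shows "norm (slice F k) = 1"
proof (rule ccontr)
  assume "norm (slice F k) \<noteq> 1"
  then have lt: "norm (slice F k) < 1"
    using norm_slice_le[of F k] \<open>norm F = 1\<close> by simp
  have F: "F \<in> compact_operators"
    using sym by (simp add: right_symmetric_in_def)
  obtain k1 where k1: "norm (slice F k1) = 1"
    using norm_slice_attained[OF K F] \<open>norm F = 1\<close> by metis
  \<comment> \<open>A unit direction of \<open>slice F k\<close>; if that slice is 0,
    \<open>slice F k1\<close> supplies a unit vector.\<close>
  obtain w where w: "norm w = 1" "slice F k = norm (slice F k) *\<^sub>R w"
  proof (cases "slice F k = 0")
    case True
    with that[of "slice F k1"] k1 show ?thesis
      by simp
  next
    case False
    with that[of "slice F k /\<^sub>R norm (slice F k)"] show ?thesis
      by simp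
  qed
  \<comment> \<open>Half the gap, so that e + norm (slice F k) < 1.\<close>
  define e where "e = (1 - norm (slice F k)) / 2"
  have e: "0 < e"
    using lt by (simp add: e_def)
  define y where "y = e *\<^sub>R w"
  have "norm y = e"
    using e w(1) by (simp add: y_def)
  have ray: "norm (y + c *\<^sub>R slice F k) = \<bar>e + c * norm (slice F k)\<bar>" for c
  proof -
    have "y + c *\<^sub>R slice F k = (e + c * norm (slice F k)) *\<^sub>R w"
      unfolding y_def by (subst w(2)) (simp add: scaleR_add_left)
    then show ?thesis
      using w(1) by simp
  qed
  have "e + norm (slice F k) < 1"
    using lt unfolding e_def by argo
  then have "norm (slice F k + y) < 1"
    using ray[of 1] e by (simp add: add.commute[of "slice F k"])
  moreover have "y \<noteq> 0"
    using e \<open>norm y = e\<close> by auto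
  \<comment> \<open>This neighbourhood of \<open>k\<close> omits \<open>k1\<close>, forcing
    \<open>G\<close> to be \<open>- e\<close> times \<open>F\<close> there.\<close>
  moreover have "open {j. norm (slice F j) < 1}"
    by (intro open_Collect_less continuous_intros continuous_on_slice F)
  ultimately obtain G where G: "G \<in> compact_operators" "slice G k = y" "norm G = e"
    "\<And>j. j \<notin> {j. norm (slice F j) < 1} \<Longrightarrow> slice G j = - e *\<^sub>R slice F j" "\<not> F \<bottom>\<^sub>B G"
    using localised_perturbation[OF K F \<open>norm F = 1\<close>, of "{j. norm (slice F j) < 1}" k y] lt
      \<open>norm y = e\<close> by auto
  have Gk1: "slice G k1 = - e *\<^sub>R slice F k1"
    using G(4)[of k1] k1 by simp
  \<comment> \<open>For c \<ge> 0 both slices at \<open>k\<close> are nonnegative multiples of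
    \<open>w\<close>, so their norms add; for c < 0 the norm at \<open>k1\<close> is e - c >
    e.\<close>
  have "norm G \<le> norm (G + c *\<^sub>R F)" for c
  proof (cases "0 \<le> c")
    case True
    then have "norm G \<le> norm (slice (G + c *\<^sub>R F) k)"
      using ray[of c] e G(2,3) by (simp add: slice_add slice_scaleR)
    then show ?thesis
      using norm_slice_le order_trans by blast
  next
    case False
    have "slice (G + c *\<^sub>R F) k1 = (c - e) *\<^sub>R slice F k1"
      by (simp add: slice_add slice_scaleR Gk1 algebra_simps)
    then have "norm G \<le> norm (slice (G + c *\<^sub>R F) k1)"
      using False e G(3) k1 by simp
    then show ?thesis
      using norm_slice_le order_trans by blast
  qed
  then have "G \<bottom>\<^sub>B F"
    by (simp add: birkhoff_orthogonal_def)
  with sym G(1,5) show False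
    by (simp add: right_symmetric_in_def)
qed

lemma slice_right_symmetric:
  fixes F :: "'x::real_normed_vector \<Rightarrow>\<^sub>L ('k::t2_space \<Rightarrow>\<^sub>C real)"
  assumes K: "compact (UNIV :: 'k set)" and "norm F = 1"
    and sym: "right_symmetric_in F compact_operators"
  shows "right_symmetric_in (slice F k) UNIV"
proof (rule ccontr)
  assume "\<not> right_symmetric_in (slice F k) UNIV"
  then obtain z c where z: "z \<bottom>\<^sub>B slice F k" and "norm (slice F k + c *\<^sub>R z) < norm (slice F k)"
    by (auto simp: right_symmetric_in_def birkhoff_orthogonal_def not_le)
  define y where "y = c *\<^sub>R z"
  \<comment> \<open>The slice at \<open>k\<close> has norm 1 by the previous lemma, so the failing
    scalar \<open>c\<close> gives a \<open>y\<close> fit for the perturbation.\<close>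
  have y: "norm (slice F k + y) < 1" "y \<noteq> 0"
    using \<open>norm (slice F k + c *\<^sub>R z) < _\<close> norm_slice_if_right_symmetric[OF assms, of k]
    by (auto simp: y_def)
  have orth: "norm y \<le> norm (y + a *\<^sub>R slice F k)" for a
  proof -
    have "norm z \<le> norm (z + (a / c) *\<^sub>R slice F k)"
      using z by (simp add: birkhoff_orthogonal_def)
    then have "\<bar>c\<bar> * norm z \<le> \<bar>c\<bar> * norm (z + (a / c) *\<^sub>R slice F k)"
      by (intro mult_left_mono) auto
    also have "\<dots> = norm (y + a *\<^sub>R slice F k)"
      using y(2) by (simp flip: norm_scaleR add: y_def scaleR_add_right)
    finally show ?thesis
      by (simp add: y_def)
  qed
  have F: "F \<in> compact_operators"
    using sym by (simp add: right_symmetric_in_def)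
  obtain G where G: "G \<in> compact_operators" "slice G k = y" "norm G = norm y" "\<not> F \<bottom>\<^sub>B G"
    \<comment> \<open>The value at \<open>k\<close> alone yields G \<bottom> F, so nothing need be
      prescribed elsewhere and \<open>V\<close> is the whole space.\<close>
    using localised_perturbation[OF K F \<open>norm F = 1\<close> open_UNIV UNIV_I y] by blast
  have "norm G \<le> norm (G + a *\<^sub>R F)" for a
    using orth[of a] norm_slice_le[of "G + a *\<^sub>R F" k] G(2,3)
    by (simp add: slice_add slice_scaleR)
  then have "G \<bottom>\<^sub>B F"
    by (simp add: birkhoff_orthogonal_def)
  with sym G(1,4) show False
    by (simp add: right_symmetric_in_def)
qed

theorem proposition3p26:
  fixes T :: "'x::banach \<Rightarrow>\<^sub>L ('k::t2_space \<Rightarrow>\<^sub>C real)"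
  assumes "compact (UNIV :: 'k set)"
    and "T \<in> compact_operators"
    and "norm T = 1"
  shows "right_symmetric_in T compact_operators \<longleftrightarrow>
    (\<forall>k::'k. norm (adjoint_operator T (point_evaluation k)) = 1) \<and>
    (\<forall>k::'k. right_symmetric_in (adjoint_operator T (point_evaluation k)) UNIV)"
  using right_symmetric_if_slices[OF assms] norm_slice_if_right_symmetric[OF assms(1,3)]
    slice_right_symmetric[OF assms(1,3)]
  by blast

end
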